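(* Consider the $JT_\mu$ flow of the BMS free scalar with seed Lagrangian $\mathcal L^{(0)}=(\partial_y\phi)^2$, reduced to its single coupling $\lambda=\lambda^1$, i.e. the sequence $\mathcal L^{(n)}$, $n\ge0$, of functions of $\partial_y\phi$ determined by $\mathcal L^{(0)}$ and the recursion $$\mathcal L^{(n+1)}=\sum_{i=0}^n\binom{n}{i}\,j^y_{(n-i)}\,T^{x(i)}_{\ x},\qquad T^{x(i)}_{\ x}=-\mathcal L^{(i)},\qquad j^y_{(n-i)}=-\frac{\partial\mathcal L^{(n-i)}}{\partial(\partial_y\phi)} .$$ Then for all $n\ge0$ $$\mathcal L^{(n)}=\frac{2^{1+2n}}{(1+n)(2+n)}\,\frac{\Gamma(\tfrac32+n)}{\Gamma(\tfrac32)}\,(\partial_y\phi)^{n+2},$$ and the deformed Lagrangian is, as a formal power series in $\lambda$, $$\mathcal L^{[\lambda]}=\sum_{n=0}^\infty\frac{\lambda^n}{n!}\mathcal L^{(n)}=\frac{1-2\lambda\,\partial_y\phi-\sqrt{1-4\lambda\,\partial_y\phi}}{2\lambda^2}.$$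
   Context: $\phi=\phi(x,y)$ is a real scalar field and $\partial_y\phi$ is treated as an independent commuting variable (classical Lagrangian). The recursion is the Taylor expansion in $\lambda$ of the flow equation $\frac{\partial\mathcal L^{[\lambda]}}{\partial\lambda}=j^y_{[\lambda]}T^{x[\lambda]}_{\ x}$ with $\mathcal L^{[0]}=(\partial_y\phi)^2$, $T^{x[\lambda]}_{\ x}=-\mathcal L^{[\lambda]}$, $j^y_{[\lambda]}=-\partial\mathcal L^{[\lambda]}/\partial(\partial_y\phi)$, where $\mathcal L^{[\lambda]}=\sum_n\frac{\lambda^n}{n!}\mathcal L^{(n)}$, and similarly for $T^{x[\lambda]}_{\ x}$ and $j^y_{[\lambda]}$. *)

theory Defs
  imports "HOL-Analysis.Analysis" "HOL-Computational_Algebra.Computational_Algebra"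
begin

text \<open>
  A classical Lagrangian of the flow depends on the field only through \<open>p = \<partial>\<^sub>y \<phi>\<close>, which is an
  independent commuting variable; it is a function \<open>real \<Rightarrow> real\<close> of \<open>p\<close>.
  The component \<open>T\<^sup>x\<^sub>x\<close> of the stress tensor and the current component \<open>j\<^sup>y\<close> are linear in the Lagrangian, so the
  same operators apply to each Taylor coefficient in \<open>\<lambda>\<close>.
\<close>

definition stress_Txx :: "(real \<Rightarrow> real) \<Rightarrow> real \<Rightarrow> real" where
  "stress_Txx L = (\<lambda>p. - L p)"

definition current_jy :: "(real \<Rightarrow> real) \<Rightarrow> real \<Rightarrow> real" where
  "current_jy L = (\<lambda>p. - deriv L p)"

fun lagrangian_coeff :: "nat \<Rightarrow> real \<Rightarrow> real" where
  "lagrangian_coeff 0 = (\<lambda>p. p ^ 2)"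
| "lagrangian_coeff (Suc n) =
     (\<lambda>p. \<Sum>i=0..n. real (n choose i)
              * current_jy (lagrangian_coeff (n - i)) p
              * stress_Txx (lagrangian_coeff i) p)"

text \<open>
  The formal variable of the power series is the coupling \<open>\<lambda>\<close>; equality of formal power series
  whose coefficients are functions of \<open>p\<close> is equality for every value of \<open>p\<close>.
\<close>

definition deformed_lagrangian :: "real \<Rightarrow> real fps" where
  "deformed_lagrangian p = Abs_fps (\<lambda>n. lagrangian_coeff n p / fact n)"

text \<open>Formal square root whose constant term is the real square root of the constant term.\<close>

abbreviation fps_sqrt :: "real fps \<Rightarrow> real fps" where
  "fps_sqrt f \<equiv> fps_radical root 2 f"

end

theory Submission
  imports Defs
begin

unbundle no vec_syntax

text \<open>
  Homogeneity suggests \<open>L\<^sup>(\<^sup>n\<^sup>) = n! a\<^sub>n p\<^bsup>n+2\<^esup>\<close>, which turns the flow into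
  \<open>(n+1) a\<^bsub>n+1\<^esub> = \<Sum>i\<le>n. (n-i+2) a\<^bsub>n-i\<^esub> a\<^sub>i\<close>. Symmetrising in \<open>i\<close> and \<open>n-i\<close> replaces the weight
  \<open>n-i+2\<close> by \<open>(n+4)/2\<close>. If \<open>A = \<Sum>n. a\<^sub>n X\<^sup>n\<close> is defined by \<open>sqrt (1 - 4 X) = 1 - 2 X - 2 X\<^sup>2 A\<close>, squaring
  gives \<open>X\<^sup>2 A\<^sup>2 = (1 - 2 X) A - 1\<close>, which evaluates the remaining convolution, and the
  two-term recurrence of the binomial coefficients of \<open>1/2\<close> then yields the recursion.
\<close>

definition sqrt_series :: "real \<Rightarrow> real fps" where
  "sqrt_series c = fps_binomial (1 / 2) oo (fps_const c * fps_X)"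

lemma sqrt_series_nth: "sqrt_series c $ n = c ^ n * ((1 / 2) gchoose n)"
  by (simp add: sqrt_series_def fps_compose_linear)

lemma sqrt_series_square: "sqrt_series c ^ 2 = 1 + fps_const c * fps_X"
proof -
  have "fps_binomial (1 / 2) * fps_binomial (1 / 2) = (1 + fps_X :: real fps)"
    by (simp flip: fps_binomial_add_mult add: fps_binomial_1)
  then show ?thesis
    by (simp add: sqrt_series_def power2_eq_square fps_compose_add_distrib
        flip: fps_compose_mult_distrib)
qed

text \<open>A formal square root is determined by its square and its constant term. Here the
  constant term is 1, which is its own real square root.\<close>

lemma fps_sqrt_linear: "fps_sqrt (1 + fps_const c * fps_X) = sqrt_series c"
  using radical_unique[of root 1 "1 + fps_const c * fps_X" "sqrt_series c"] sqrt_series_square[of c]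
  by (simp add: numeral_2_eq_2 sqrt_series_nth)

text \<open>The shifted Catalan number \<open>C\<^bsub>n+1\<^esub>\<close>.\<close>

definition flow_coeff :: "nat \<Rightarrow> real" where
  "flow_coeff n = - sqrt_series (- 4) $ (n + 2) / 2"

lemma gchoose_half_2: "((1 / 2) gchoose 2) = (- 1 / 8 :: real)"
  using gbinomial_mult_1[of "1 / 2 :: real" 1] by (simp add: numeral_2_eq_2)

lemma flow_coeff_0: "flow_coeff 0 = 1"
  by (simp add: flow_coeff_def sqrt_series_nth gchoose_half_2 flip: numeral_2_eq_2)

lemma flow_coeff_Suc: "(real n + 3) * flow_coeff (Suc n) = 2 * (2 * real n + 3) * flow_coeff n"
proof -
  define b where "b k = ((1 / 2 :: real) gchoose k)" for k
  have "(real n + 3) * b (Suc (n + 2)) = - (real n + 3 / 2) * b (n + 2)"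
    using gbinomial_mult_1[of "1 / 2 :: real" "n + 2"]
    by (simp add: b_def algebra_simps)
  \<comment> \<open>The multiplier equals \<open>- (- 4) ^ (n + 3) / 2\<close>, the factor of the
    binomial coefficient in \<open>flow_coeff (Suc n)\<close>.\<close>
  then have "(- 4) ^ (n + 2) * 2 * ((real n + 3) * b (Suc (n + 2)))
      = (- 4) ^ (n + 2) * 2 * (- (real n + 3 / 2) * b (n + 2))"
    by simp
  then show ?thesis
    by (simp add: flow_coeff_def sqrt_series_nth algebra_simps flip: b_def)
qed

text \<open>The defining relation of the coefficients with \<open>p X\<close> substituted for
  \<open>X\<close>: the case \<open>p = 1\<close> gives the quadratic equation, general
  \<open>p\<close> the deformed Lagrangian.\<close>

lemma sqrt_series_eq:
  "sqrt_series (- 4 * p) = 1 - 2 * fps_X * fps_const p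
     - 2 * fps_X ^ 2 * Abs_fps (\<lambda>n. flow_coeff n * p ^ (n + 2))"
proof (rule fps_ext)
  fix n :: nat
  consider "n = 0" | "n = 1" | m where "n = m + 2"
    by (metis One_nat_def Suc_eq_plus1 add_2_eq_Suc' not0_implies_Suc)
  then show "sqrt_series (- 4 * p) $ n = (1 - 2 * fps_X * fps_const p
     - 2 * fps_X ^ 2 * Abs_fps (\<lambda>n. flow_coeff n * p ^ (n + 2))) $ n"
    by cases (simp_all add: sqrt_series_nth flow_coeff_def mult.assoc numeral_fps_const
        fps_X_power_mult_nth power_mult_distrib[of "- 4" p, simplified])
qed

lemma flow_coeff_convolution:
  "(\<Sum>i=0..n. flow_coeff i * flow_coeff (n - i)) = flow_coeff (n + 2) - 2 * flow_coeff (n + 1)"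
proof -
  define A where "A = Abs_fps flow_coeff"
  have "1 - 4 * fps_X = (1 - 2 * fps_X - 2 * fps_X ^ 2 * A) ^ 2"
    using sqrt_series_square[of "- 4"] sqrt_series_eq[of 1]
    by (simp add: A_def numeral_fps_const)
  then have "4 * fps_X ^ 2 * (fps_X ^ 2 * A ^ 2) = 4 * fps_X ^ 2 * (A - 2 * (fps_X * A) - 1)"
    by algebra
  \<comment> \<open>Formal power series form an integral domain, so \<open>4 * fps_X ^ 2\<close>
    cancels. In degree \<open>n + 2\<close> the constant 1 contributes nothing.\<close>
  then have "(fps_X ^ 2 * A ^ 2) $ (n + 2) = (A - 2 * (fps_X * A) - 1) $ (n + 2)"
    by simp
  then have "(A * A) $ n = A $ (n + 2) - 2 * A $ (n + 1)"
    by (simp add: fps_X_power_mult_nth numeral_fps_const flip: power2_eq_square)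
  then show ?thesis
    by (simp add: fps_mult_nth A_def)
qed

lemma flow_coeff_recursion:
  "(\<Sum>i=0..n. (real (n - i) + 2) * flow_coeff (n - i) * flow_coeff i)
     = (real n + 1) * flow_coeff (Suc n)" (is "?S = _")
proof -
  have "?S = (\<Sum>i=0..n. (real i + 2) * flow_coeff i * flow_coeff (n - i))" (is "_ = ?T")
    by (subst sum.atLeastAtMost_rev) (auto intro!: sum.cong)
  then have "2 * ?S = ?S + ?T"
    by simp
  also have "\<dots> = (\<Sum>i=0..n. (real n + 4) * (flow_coeff i * flow_coeff (n - i)))"
    by (simp only: flip: sum.distrib) (auto simp: of_nat_diff algebra_simps intro!: sum.cong)
  also have "\<dots> = (real n + 4) * (flow_coeff (n + 2) - 2 * flow_coeff (n + 1))"
    by (simp only: flow_coeff_convolution flip: sum_distrib_left)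
  \<comment> \<open>The two-term recurrence at \<open>Suc n\<close> leaves the factor
    \<open>2 * (2 * n + 5) - 2 * (n + 4) = 2 * (n + 1)\<close>.\<close>
  also have "\<dots> = 2 * ((real n + 1) * flow_coeff (Suc n))"
    using flow_coeff_Suc[of "Suc n"] by (simp add: algebra_simps)
  finally show ?thesis
    by simp
qed

text \<open>An equality of functions, because the recursion differentiates earlier coefficients;
  since it involves all of them, the induction is strong.\<close>

lemma lagrangian_coeff_eq: "lagrangian_coeff n = (\<lambda>p. fact n * flow_coeff n * p ^ (n + 2))"
proof (induction n rule: less_induct)
  case (less n)
  show ?case
  proof (cases n)
    case 0
    then show ?thesis by (simp add: flow_coeff_0 fun_eq_iff power2_eq_square)
  next
    case (Suc m)
    have L: "lagrangian_coeff k p = fact k * flow_coeff k * p ^ (k + 2)" if "k \<le> m" for k p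
      using less[of k] that Suc by simp
    have D: "deriv (lagrangian_coeff k) p = fact k * flow_coeff k * ((real k + 2) * p ^ (k + 1))"
      if "k \<le> m" for k p
    proof -
      have "((\<lambda>p. fact k * flow_coeff k * p ^ (k + 2)) has_real_derivative
              fact k * flow_coeff k * ((real k + 2) * p ^ (k + 1))) (at p)"
        by (rule derivative_eq_intros refl | simp)+
      then show ?thesis
        using less[of k] that Suc by (simp add: DERIV_imp_deriv)
    qed
    have "lagrangian_coeff n p = fact n * flow_coeff n * p ^ (n + 2)" for p
    proof -
      have "lagrangian_coeff n p = (\<Sum>i=0..m. real (m choose i)
              * deriv (lagrangian_coeff (m - i)) p * lagrangian_coeff i p)"
        by (simp add: Suc current_jy_def stress_Txx_def)
      \<comment> \<open>The factorials absorb the binomial coefficient and the powers of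
        \<open>p\<close> combine to one independent of \<open>i\<close>.\<close>
      also have "\<dots> = (\<Sum>i=0..m. fact m * p ^ (m + 3) *
              ((real (m - i) + 2) * flow_coeff (m - i) * flow_coeff i))"
      proof (rule sum.cong)
        fix i assume "i \<in> {0..m}"
        then have i: "i \<le> m" by simp
        have "p ^ (m - i + 1) * p ^ (i + 2) = p ^ (m + 3)"
          using i by (simp add: numeral_3_eq_3 flip: power_add)
        moreover have "real (m choose i) * fact (m - i) * fact i = fact m"
          using binomial_fact[OF i, where ?'a = real] by simp
        moreover have "real (m choose i) * deriv (lagrangian_coeff (m - i)) p * lagrangian_coeff i p
            = (real (m choose i) * fact (m - i) * fact i) * (p ^ (m - i + 1) * p ^ (i + 2))
                * ((real (m - i) + 2) * flow_coeff (m - i) * flow_coeff i)"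
          unfolding L[OF i] D[OF diff_le_self] by (simp only: mult_ac)
        ultimately show "real (m choose i) * deriv (lagrangian_coeff (m - i)) p * lagrangian_coeff i p
            = fact m * p ^ (m + 3) * ((real (m - i) + 2) * flow_coeff (m - i) * flow_coeff i)"
          by (simp only:)
      qed simp
      also have "\<dots> = fact m * p ^ (m + 3) * ((real m + 1) * flow_coeff n)"
        by (simp only: flow_coeff_recursion Suc flip: sum_distrib_left)
      finally show ?thesis
        by (simp add: Suc algebra_simps eval_nat_numeral)
    qed
    then show ?thesis by blast
  qed
qed

text \<open>Both sides equal 1 at \<open>n = 0\<close> and have the same ratio of consecutive terms,
  by the functional equation of \<open>Gamma\<close>.\<close>

lemma flow_coeff_closed_form:
  "fact n * flow_coeff n = 2 ^ (1 + 2 * n) / ((1 + real n) * (2 + real n))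
     * (Gamma (3 / 2 + real n) / Gamma (3 / 2))"
proof (induction n)
  case 0
  have "Gamma (3 / 2 :: real) \<noteq> 0"
    using Gamma_real_pos[of "3 / 2"] by linarith
  then show ?case by (simp add: flow_coeff_0)
next
  case (Suc n)
  have "Gamma (3 / 2 + real (Suc n)) = (3 / 2 + real n) * Gamma (3 / 2 + real n)"
    using Gamma_plus1[of "3 / 2 + real n"] by (simp add: add_ac nonpos_Ints_def)
  then have G: "Gamma (3 / 2 + real (Suc n)) / Gamma (3 / 2)
      = (3 / 2 + real n) * (Gamma (3 / 2 + real n) / Gamma (3 / 2))"
    by simp
  have "flow_coeff (Suc n) = 2 * (2 * real n + 3) / (real n + 3) * flow_coeff n"
    using flow_coeff_Suc[of n] by (simp add: field_simps)
  then have "fact (Suc n) * flow_coeff (Suc n)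
      = (real n + 1) * (2 * (2 * real n + 3) / (real n + 3)) * (fact n * flow_coeff n)"
    by (simp add: algebra_simps)
  \<comment> \<open>With the Gamma quotient abstracted to \<open>g\<close>, only a rational identity
    in \<open>n\<close> remains.\<close>
  moreover have "(real n + 1) * (2 * (2 * real n + 3) / (real n + 3))
        * (2 ^ (1 + 2 * n) / ((1 + real n) * (2 + real n)) * g)
      = 2 ^ (1 + 2 * Suc n) / ((1 + real (Suc n)) * (2 + real (Suc n))) * ((3 / 2 + real n) * g)"
    for g by (simp add: divide_simps) (simp add: algebra_simps)
  ultimately show ?case
    unfolding Suc.IH G by (simp only:)
qed

lemma deformed_lagrangian_eq:
  "2 * fps_X ^ 2 * deformed_lagrangian p
     = 1 - 2 * fps_X * fps_const p - fps_sqrt (1 - 4 * fps_X * fps_const p)"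
proof -
  have "1 - 4 * fps_X * fps_const p = 1 + fps_const (- 4 * p) * fps_X"
    by (simp add: numeral_fps_const algebra_simps flip: fps_const_mult fps_const_neg)
  then have "fps_sqrt (1 - 4 * fps_X * fps_const p) = sqrt_series (- 4 * p)"
    by (simp only: fps_sqrt_linear)
  moreover have "deformed_lagrangian p = Abs_fps (\<lambda>n. flow_coeff n * p ^ (n + 2))"
    by (simp add: deformed_lagrangian_def lagrangian_coeff_eq)
  ultimately show ?thesis
    unfolding sqrt_series_eq by simp
qed

(* The quotient by 2 lambda^2 is taken in the field of formal Laurent series: division of
   formal power series by a non-unit would silently discard low-order terms. *)
theorem mainTheorem3:
  shows "(\<forall>(n::nat) (p::real).
            lagrangian_coeff n p =
              2 ^ (1 + 2 * n) / ((1 + real n) * (2 + real n))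
                * (Gamma (3 / 2 + real n) / Gamma (3 / 2)) * p ^ (n + 2))
       \<and> (\<forall>p::real.
            fps_to_fls (deformed_lagrangian p) =
              fps_to_fls (1 - 2 * fps_X * fps_const p
                            - fps_sqrt (1 - 4 * fps_X * fps_const p))
                / (2 * fls_X ^ 2))"
proof (intro conjI allI)
  fix n and p :: real
  show "lagrangian_coeff n p = 2 ^ (1 + 2 * n) / ((1 + real n) * (2 + real n))
          * (Gamma (3 / 2 + real n) / Gamma (3 / 2)) * p ^ (n + 2)"
    by (simp only: lagrangian_coeff_eq flow_coeff_closed_form)
next
  fix p :: real
  have "fps_to_fls (2 * fps_X ^ 2 * deformed_lagrangian p)
      = 2 * fls_X ^ 2 * fps_to_fls (deformed_lagrangian p)"
    by (simp add: fls_times_fps_to_fls fps_to_fls_power)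
  moreover have "2 * fls_X ^ 2 \<noteq> (0 :: real fls)"
    by simp
  ultimately have "fps_to_fls (deformed_lagrangian p)
      = fps_to_fls (2 * fps_X ^ 2 * deformed_lagrangian p) / (2 * fls_X ^ 2)"
    by (metis nonzero_mult_div_cancel_left)
  then show "fps_to_fls (deformed_lagrangian p) =
      fps_to_fls (1 - 2 * fps_X * fps_const p - fps_sqrt (1 - 4 * fps_X * fps_const p))
        / (2 * fls_X ^ 2)"
    by (simp only: deformed_lagrangian_eq)
qed

end
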